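(* Let $f,g:[a,b]\to\mathbb{R}$ be two functions such that $f,g$ are differentiable, and let $0<\alpha<1$. Then $$\int_a^b f(x)\,\mathscr{D}_M^{\alpha,\beta}g(x)\,d_\alpha x=f(x)g(x)\Big|_a^b-\int_a^b g(x)\,\mathscr{D}_M^{\alpha,\beta}f(x)\,d_\alpha x ,$$ with $\beta>0$.
   Context: For $\beta>0$, $\mathbb{E}_\beta(x)=\sum_{k=0}^\infty \frac{x^k}{\Gamma(\beta k+1)}$ is the one-parameter Mittag-Leffler function. For $0<\alpha<1$, $\beta>0$ and $t>0$, the local $M$-derivative of order $\alpha$ of a real-valued function $f$ at $t$ is $$\mathscr{D}_M^{\alpha,\beta}f(t)=\lim_{\varepsilon\to 0}\frac{f\big(t\,\mathbb{E}_\beta(\varepsilon t^{-\alpha})\big)-f(t)}{\varepsilon}.$$ The notation $d_\alpha x$ means $d_\alpha x=\frac{\Gamma(\beta+1)}{x^{1-\alpha}}\,dx$, so that, for $a\ge0$, $\int_a^t h(x)\,d_\alpha x=\Gamma(\beta+1)\int_a^t\frac{h(x)}{x^{1-\alpha}}\,dx$ is the $M$-integral of order $\alpha$ of $h$ from $a$ to $t$.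
   Formalization: For merely differentiable f, g the integrals may fail to exist (e.g. f = x² sin(x⁻⁴), g = x² cos(x⁻⁴) on [0,1]), so it is assumed that at least one of the two integrals exists; existence of the other is then proved. *)

theory Defs
  imports "HOL-Analysis.Analysis"
begin

definition mittag_leffler :: "real \<Rightarrow> real \<Rightarrow> real" where
  "mittag_leffler \<beta> x = (\<Sum>k. x ^ k / Gamma (\<beta> * real k + 1))"

text \<open>
  Functions on \<open>[a,b]\<close> are represented by total functions. The two-sided limit below depends
  only on the values of \<open>f\<close> near \<open>t\<close>, so on the open interval \<open>(a,b)\<close> it does not see the
  values of \<open>f\<close> outside \<open>[a,b]\<close>. Its values at the end points, and at \<open>t = 0\<close>, where it is
  not meaningful, do not affect integrals over \<open>[a,b]\<close>.
\<close>

definition M_derivative :: "real \<Rightarrow> real \<Rightarrow> (real \<Rightarrow> real) \<Rightarrow> real \<Rightarrow> real" where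
  "M_derivative \<alpha> \<beta> f t =
     Lim (at 0) (\<lambda>\<epsilon>. (f (t * mittag_leffler \<beta> (\<epsilon> * t powr (- \<alpha>))) - f t) / \<epsilon>)"

text \<open>
  The integral is the Henstock-Kurzweil integral, which agrees with the (proper or improper)
  Riemann integral and with the Lebesgue integral whenever these exist; in particular it covers
  the singularity of the weight at \<open>0\<close>. Since \<open>Gamma (\<beta> + 1)\<close> is a nonzero constant for
  \<open>\<beta> > 0\<close>, it plays no role for integrability.
\<close>

definition M_integrable :: "real \<Rightarrow> (real \<Rightarrow> real) \<Rightarrow> real \<Rightarrow> real \<Rightarrow> bool" where
  "M_integrable \<alpha> h a t \<longleftrightarrow> (\<lambda>x. h x / x powr (1 - \<alpha>)) integrable_on {a..t}"

definition M_integral :: "real \<Rightarrow> real \<Rightarrow> (real \<Rightarrow> real) \<Rightarrow> real \<Rightarrow> real \<Rightarrow> real" where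
  "M_integral \<alpha> \<beta> h a t = Gamma (\<beta> + 1) * integral {a..t} (\<lambda>x. h x / x powr (1 - \<alpha>))"

end

theory Submission
  imports Defs
begin

text \<open>
  By the chain rule, the $M$-derivative at an interior point \<open>t > 0\<close> is
  \<open>t powr (1 - \<alpha>) * f' t / Gamma (\<beta> + 1)\<close>, because the Mittag-Leffler function has value 1 and
  derivative \<open>1 / Gamma (\<beta> + 1)\<close> at 0. The weight \<open>1 / x powr (1 - \<alpha>)\<close> cancels the power, so the
  two integrands add up to the derivative of \<open>f * g / Gamma (\<beta> + 1)\<close> on the open interval, and the
  fundamental theorem of calculus applies.
\<close>

text \<open>Compactness gives a minimum on \<open>{1..2}\<close>, and the recurrence
  \<open>Gamma (x + 1) = x * Gamma x\<close> cannot decrease the value once x \<ge> 1. The constant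
  bounds the Mittag-Leffler coefficients.\<close>

lemma Gamma_real_bounded_below:
  obtains c :: real where "c > 0" and "\<And>x. x \<ge> 1 \<Longrightarrow> c \<le> Gamma x"
proof -
  have "continuous_on {1..2::real} Gamma"
    by (intro continuous_on_Gamma) (auto elim!: nonpos_Ints_cases)
  then obtain y :: real where y: "y \<in> {1..2}" "\<And>x. x \<in> {1..2} \<Longrightarrow> Gamma y \<le> Gamma x"
    using continuous_attains_inf[of "{1..2::real}" Gamma] by auto
  have shift: "Gamma y \<le> Gamma (x + real n)" if "x \<in> {1..2}" for x n
  proof (induction n)
    case 0
    show ?case using y that by simp
  next
    case (Suc n)
    have pos: "Gamma (x + real n) > 0" and ge: "x + real n \<ge> 1"
      using that by (auto intro!: Gamma_real_pos)
    have "x + real n \<notin> \<int>\<^sub>\<le>\<^sub>0" using ge by (auto elim!: nonpos_Ints_cases)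
    then have "Gamma (x + real (Suc n)) = (x + real n) * Gamma (x + real n)"
      using Gamma_plus1[of "x + real n"] by (simp add: add_ac)
    also have "\<dots> \<ge> 1 * Gamma (x + real n)"
      using pos ge by (intro mult_right_mono) auto
    finally show ?case using Suc by simp
  qed
  show ?thesis
  proof
    show "Gamma y > 0" using y(1) by (auto intro: Gamma_real_pos)
    fix x :: real assume "x \<ge> 1"
    \<comment> \<open>Every x \<ge> 1 is a natural shift of a point of \<open>{1..2}\<close>; the
      floor is at least 1, so \<open>nat\<close> truncates nothing.\<close>
    then have "x = (1 + frac x) + real (nat (\<lfloor>x\<rfloor> - 1))"
      by (simp add: frac_def le_floor_iff)
    moreover have "1 + frac x \<in> {1..2}"
      using frac_ge_0[of x] frac_lt_1[of x] by simp
    ultimately show "Gamma y \<le> Gamma x" using shift by metis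
  qed
qed

lemma mittag_leffler_0 [simp]: "mittag_leffler \<beta> 0 = 1"
  using powser_zero[of "\<lambda>k. 1 / Gamma (\<beta> * real k + 1)"]
  by (simp add: mittag_leffler_def)

text \<open>The coefficients are bounded, so a geometric series dominates. The unit disc suffices,
  since only the behaviour near 0 enters the derivative.\<close>

lemma mittag_leffler_summable:
  assumes "\<beta> \<ge> 0" and "\<bar>x\<bar> < 1"
  shows "summable (\<lambda>k. 1 / Gamma (\<beta> * real k + 1) * x ^ k)"
proof -
  obtain c :: real where c: "c > 0" "\<And>x. x \<ge> 1 \<Longrightarrow> c \<le> Gamma x"
    using Gamma_real_bounded_below by blast
  show ?thesis
  proof (rule summable_comparison_test')
    show "summable (\<lambda>k. 1 / c * \<bar>x\<bar> ^ k)"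
      using assms by (intro summable_mult summable_geometric) auto
    fix k :: nat
    have "c \<le> Gamma (\<beta> * real k + 1)"
      using assms by (intro c(2)) auto
    then show "norm (1 / Gamma (\<beta> * real k + 1) * x ^ k) \<le> 1 / c * \<bar>x\<bar> ^ k"
      using c(1) by (auto simp: abs_mult power_abs intro!: mult_right_mono divide_left_mono frac_le)
  qed
qed

lemma mittag_leffler_has_derivative_0:
  assumes "\<beta> \<ge> 0"
  shows "(mittag_leffler \<beta> has_real_derivative 1 / Gamma (\<beta> + 1)) (at 0)"
proof -
  let ?c = "\<lambda>k. 1 / Gamma (\<beta> * real k + 1)"
  have "((\<lambda>x. \<Sum>k. ?c k * x ^ k) has_real_derivative (\<Sum>k. diffs ?c k * 0 ^ k)) (at 0)"
    \<comment> \<open>Termwise differentiation at 0 needs convergence at some point of larger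
      modulus; 1/2 is an arbitrary choice inside the unit disc.\<close>
    by (rule termdiffs_strong[of _ "1/2"]) (use mittag_leffler_summable assms in auto)
  moreover have "(\<Sum>k. diffs ?c k * 0 ^ k) = 1 / Gamma (\<beta> + 1)"
    by (subst powser_zero) (simp add: diffs_def)
  moreover have "(\<lambda>x. \<Sum>k. ?c k * x ^ k) = mittag_leffler \<beta>"
    by (simp add: fun_eq_iff mittag_leffler_def)
  ultimately show ?thesis by simp
qed

lemma M_derivative_eq:
  assumes "t > 0" and "\<beta> \<ge> 0" and f: "(f has_real_derivative D) (at t)"
  shows "M_derivative \<alpha> \<beta> f t = t powr (1 - \<alpha>) * D / Gamma (\<beta> + 1)"
proof -
  let ?u = "\<lambda>\<epsilon>. t * mittag_leffler \<beta> (\<epsilon> * t powr (- \<alpha>))"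
  have "((\<lambda>\<epsilon>. mittag_leffler \<beta> (\<epsilon> * t powr (- \<alpha>))) has_real_derivative
      1 / Gamma (\<beta> + 1) * t powr (- \<alpha>)) (at 0)"
    by (rule DERIV_chain2[where f = "mittag_leffler \<beta>"])
      (use mittag_leffler_has_derivative_0[OF assms(2)] in
        \<open>auto intro!: derivative_eq_intros\<close>)
  then have u: "(?u has_real_derivative t * (1 / Gamma (\<beta> + 1) * t powr (- \<alpha>))) (at 0)"
    by (rule DERIV_cmult)
  have "((\<lambda>\<epsilon>. f (?u \<epsilon>)) has_real_derivative
      D * (t * (1 / Gamma (\<beta> + 1) * t powr (- \<alpha>)))) (at 0)"
    by (rule DERIV_chain2[where f = f, OF _ u]) (use f in simp)
  \<comment> \<open>As \<open>?u 0 = t\<close>, the quotient defining the M-derivative is the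
    ordinary difference quotient of the composition at 0.\<close>
  then have "((\<lambda>\<epsilon>. (f (?u \<epsilon>) - f t) / \<epsilon>) \<longlongrightarrow>
      D * (t * (1 / Gamma (\<beta> + 1) * t powr (- \<alpha>)))) (at 0)"
    by (simp add: DERIV_def)
  then have "M_derivative \<alpha> \<beta> f t = D * (t * (1 / Gamma (\<beta> + 1) * t powr (- \<alpha>)))"
    unfolding M_derivative_def by (intro tendsto_Lim) auto
  also have "t * t powr (- \<alpha>) = t powr (1 - \<alpha>)"
    using assms(1) by (simp add: powr_diff powr_minus divide_simps)
  then have "D * (t * (1 / Gamma (\<beta> + 1) * t powr (- \<alpha>))) = t powr (1 - \<alpha>) * D / Gamma (\<beta> + 1)"
    by (simp add: field_simps)
  finally show ?thesis .
qed

text \<open>Derivatives of differentiable functions can oscillate so strongly that f g' is not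
  Henstock-Kurzweil integrable. Integrability of one integrand is therefore assumed; that of the
  other follows.\<close>

theorem theorem12:
  fixes f g :: "real \<Rightarrow> real" and a b \<alpha> \<beta> :: real
  assumes "0 \<le> a" and "a \<le> b"
    and "0 < \<alpha>" and "\<alpha> < 1" and "0 < \<beta>"
    and "f differentiable_on {a..b}" and "g differentiable_on {a..b}"
    and "M_integrable \<alpha> (\<lambda>x. f x * M_derivative \<alpha> \<beta> g x) a b \<or>
         M_integrable \<alpha> (\<lambda>x. g x * M_derivative \<alpha> \<beta> f x) a b"
  shows "M_integrable \<alpha> (\<lambda>x. f x * M_derivative \<alpha> \<beta> g x) a b \<and>
         M_integrable \<alpha> (\<lambda>x. g x * M_derivative \<alpha> \<beta> f x) a b \<and>
         M_integral \<alpha> \<beta> (\<lambda>x. f x * M_derivative \<alpha> \<beta> g x) a b =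
           (f b * g b - f a * g a) - M_integral \<alpha> \<beta> (\<lambda>x. g x * M_derivative \<alpha> \<beta> f x) a b"
proof -
  \<comment> \<open>\<open>P\<close> and \<open>Q\<close> omit the factor
    \<open>Gamma (\<beta> + 1)\<close> of the M-integral, so the antiderivative of their sum carries
    its reciprocal.\<close>
  define P where "P = (\<lambda>x. f x * M_derivative \<alpha> \<beta> g x / x powr (1 - \<alpha>))"
  define Q where "Q = (\<lambda>x. g x * M_derivative \<alpha> \<beta> f x / x powr (1 - \<alpha>))"
  let ?G = "Gamma (\<beta> + 1)"
  have G: "?G > 0" using assms(5) by (intro Gamma_real_pos) simp
  have deriv: "\<exists>D. (h has_real_derivative D) (at x)"
    if "h differentiable_on {a..b}" "x \<in> {a<..<b}" for h :: "real \<Rightarrow> real" and x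
  proof -
    have "h differentiable (at x)"
      using that at_within_Icc_at[of a x b]
      by (metis differentiable_on_def greaterThanLessThan_iff atLeastAtMost_iff less_imp_le)
    then show ?thesis by (simp add: real_differentiable_def)
  qed
  have PQ: "((\<lambda>x. P x + Q x) has_integral (f b * g b / ?G - f a * g a / ?G)) {a..b}"
  \<comment> \<open>Continuity at the end points suffices here, which avoids the M-derivative there,
    in particular at 0.\<close>
  proof (rule fundamental_theorem_of_calculus_interior[OF assms(2)])
    show "continuous_on {a..b} (\<lambda>x. f x * g x / ?G)"
      using assms(6,7) G by (intro continuous_intros differentiable_imp_continuous_on) auto
    fix x assume x: "x \<in> {a<..<b}"
    obtain f' g' where f': "(f has_real_derivative f') (at x)"
      and g': "(g has_real_derivative g') (at x)"
      using deriv[OF assms(6) x] deriv[OF assms(7) x] by blast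
    have "x > 0" using x assms(1) by simp
    then have "P x + Q x = (f x * g' + g x * f') / ?G"
      unfolding P_def Q_def
      using M_derivative_eq[OF _ _ f'] M_derivative_eq[OF _ _ g'] assms(5)
      by (simp add: add_divide_distrib)
    moreover have "((\<lambda>x. f x * g x / ?G) has_real_derivative (f x * g' + g x * f') / ?G) (at x)"
      using f' g' G by (auto intro!: derivative_eq_intros simp: mult.commute)
    ultimately show "((\<lambda>x. f x * g x / ?G) has_vector_derivative P x + Q x) (at x)"
      by (simp add: has_real_derivative_iff_has_vector_derivative)
  qed
  \<comment> \<open>The sum is integrable as a derivative, so subtracting one integrable summand
    leaves the other integrable.\<close>
  have P: "P integrable_on {a..b}" if "Q integrable_on {a..b}"
    using integrable_diff[OF has_integral_integrable[OF PQ] that] by simp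
  have Q: "Q integrable_on {a..b}" if "P integrable_on {a..b}"
    using integrable_diff[OF has_integral_integrable[OF PQ] that] by simp
  have int: "P integrable_on {a..b}" "Q integrable_on {a..b}"
    using assms(8) P Q by (auto simp: M_integrable_def P_def Q_def)
  have "integral {a..b} P + integral {a..b} Q = f b * g b / ?G - f a * g a / ?G"
    using integral_unique[OF PQ] integral_add[OF int] by simp
  then have "?G * integral {a..b} P = f b * g b - f a * g a - ?G * integral {a..b} Q"
    using G by (simp add: field_simps)
  then show ?thesis
    using int by (simp add: M_integrable_def M_integral_def P_def Q_def)
qed

end
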